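(* Let $X$ be a metric space of finite Nagata-Assouad dimension and let $n\ge 0$ be an integer. Then the following conditions are equivalent: (a) the $n$-sphere $S^n$ is a Lipschitz extensor of $X$; (b) $\dim_{NA}(X)\le n$.
   Context: A function $f:(X,d_X)\to(Y,d_Y)$ is $\lambda$-Lipschitz ($\lambda\ge 0$) if $d_Y(f(x),f(y))\le\lambda\, d_X(x,y)$ for all $x,y\in X$. A metric space $E$ is a Lipschitz extensor of $X$ if there is a constant $C>0$ such that, for every $\lambda$, every subset $A\subset X$ and every $\lambda$-Lipschitz function $f:A\to E$, $f$ extends to a $C\lambda$-Lipschitz function $\tilde f:X\to E$. $S^n$ is the unit sphere in $\mathbb{R}^{n+1}$ with its usual metric. A family $\mathcal{U}_i$ of subsets of a metric space is $r$-disjoint if any two points lying in two different members of the family are at distance at least $r$. A metric space $X$ has Nagata-Assouad dimension at most $n$, written $\dim_{NA}(X)\le n$, if there is $C>0$ such that for all $r>0$ there is a cover $\mathcal{U}=\bigcup_{i=1}^{n+1}\mathcal{U}_i$ of $X$ such that each $\mathcal{U}_i$ is $r$-disjoint and every element of $\mathcal{U}$ has diameter at most $C r$. $X$ has finite Nagata-Assouad dimension if $\dim_{NA}(X)\le k$ for some integer $k\ge 0$. *)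

theory Defs
  imports "HOL-Analysis.Analysis"
begin

text \<open>A metric space is given as a subset \<open>X\<close> of a type of class \<open>metric_space\<close>, with the
  restricted distance; this includes the empty space.\<close>

definition lipschitz_extensor :: "'b::metric_space set \<Rightarrow> 'a::metric_space set \<Rightarrow> bool" where
  "lipschitz_extensor E X \<longleftrightarrow>
     (\<exists>C>0. \<forall>L A f. A \<subseteq> X \<and> f ` A \<subseteq> E \<and> L-lipschitz_on A f \<longrightarrow>
        (\<exists>g. g ` X \<subseteq> E \<and> (C * L)-lipschitz_on X g \<and> (\<forall>x\<in>A. g x = f x)))"

definition r_disjoint :: "real \<Rightarrow> 'a::metric_space set set \<Rightarrow> bool" where
  "r_disjoint r \<U> \<longleftrightarrow>
     (\<forall>U\<in>\<U>. \<forall>V\<in>\<U>. U \<noteq> V \<longrightarrow> (\<forall>x\<in>U. \<forall>y\<in>V. r \<le> dist x y))"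

text \<open>\<^const>\<open>diameter\<close> is a real supremum and hence meaningless on unbounded sets, so a bound
  on the diameter is stated together with boundedness.\<close>

definition NA_dim_le :: "'a::metric_space set \<Rightarrow> nat \<Rightarrow> bool" where
  "NA_dim_le X n \<longleftrightarrow>
     (\<exists>C>0. \<forall>r>0. \<exists>\<U> :: nat \<Rightarrow> 'a set set.
        (\<forall>i\<in>{1..n+1}. \<U> i \<subseteq> Pow X \<and> r_disjoint r (\<U> i)) \<and>
        (\<Union>i\<in>{1..n+1}. \<Union>(\<U> i)) = X \<and>
        (\<forall>i\<in>{1..n+1}. \<forall>U\<in>\<U> i. bounded U \<and> diameter U \<le> C * r))"

definition finite_NA_dim :: "'a::metric_space set \<Rightarrow> bool" where
  "finite_NA_dim X \<longleftrightarrow> (\<exists>k. NA_dim_le X k)"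

end

theory Submission
  imports Defs
begin

text \<open>Suppose first that the dimension is at most \<open>n\<close>. Extend an \<open>L\<close>-Lipschitz map into \<open>S\<^sup>n\<close>
  coordinatewise to a map \<open>F\<close> into \<open>\<real>\<^sup>n\<^sup>+\<^sup>1\<close>, and take a cover with \<open>n + 1\<close> colours at a scale
  proportional to \<open>1 / L\<close>. There are as many colours as coordinates: on the sets of colour \<open>i\<close> the
  \<open>i\<close>-th coordinate of \<open>F\<close> is nearly constant on each set, so a small Lipschitz perturbation keeps
  it away from \<open>0\<close> there. The perturbed map avoids a neighbourhood of the origin; switching the
  perturbation off where \<open>F\<close> has norm close to \<open>1\<close> and normalising gives the extension.

  Conversely, suppose that \<open>S\<^sup>n\<close> is a Lipschitz extensor and that the dimension is at most \<open>k + 1\<close> with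
  \<open>n \<le> k\<close>. A cover with \<open>k + 2\<close> colours gives bump functions \<open>\<phi> 1, \<dots>, \<phi> (k + 2)\<close>. Vectors in
  \<open>\<real>\<^sup>n\<^sup>+\<^sup>2\<close> with minimum \<open>0\<close> correspond to \<open>\<real>\<^sup>n\<^sup>+\<^sup>1\<close> by subtracting the last coordinate, so the extensor
  property allows one to change the first \<open>n + 2\<close> bumps, leaving them proportional to themselves
  where their minimum is already \<open>0\<close>, so that their minimum is \<open>0\<close> everywhere. Supports do not
  grow, hence the cells stay bounded and separated. As now at each point some function vanishes and
  some function is large, the sorted list of values has a definite gap; colouring a point by the
  number of values above the gap uses only \<open>k + 1\<close> colours. Thus the dimension can be lowered
  step by step down to \<open>n\<close>.\<close>

subsection \<open>Lipschitz functions\<close>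

lemma lipschitz_on_realI:
  fixes f :: "'a::metric_space \<Rightarrow> real"
  assumes "0 \<le> L" and "\<And>x y. x \<in> A \<Longrightarrow> y \<in> A \<Longrightarrow> f x \<le> f y + L * dist x y"
  shows "L-lipschitz_on A f"
proof (rule lipschitz_onI)
  fix x y assume "x \<in> A" "y \<in> A"
  then show "dist (f x) (f y) \<le> L * dist x y"
    using assms(2)[of x y] assms(2)[of y x] by (auto simp: dist_real_def dist_commute abs_le_iff)
qed (fact assms(1))

lemma lipschitz_on_realD:
  fixes f :: "'a::metric_space \<Rightarrow> real"
  assumes "L-lipschitz_on A f" "x \<in> A" "y \<in> A"
  shows "f x \<le> f y + L * dist x y"
  using lipschitz_onD[OF assms] by (auto simp: dist_real_def)

lemma lipschitz_on_max:
  fixes f g :: "'a::metric_space \<Rightarrow> real"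
  assumes "L-lipschitz_on A f" "L-lipschitz_on A g"
  shows "L-lipschitz_on A (\<lambda>x. max (f x) (g x))"
proof (rule lipschitz_on_realI)
  fix x y assume xy: "x \<in> A" "y \<in> A"
  show "max (f x) (g x) \<le> max (f y) (g y) + L * dist x y"
    using lipschitz_on_realD[OF assms(1) xy] lipschitz_on_realD[OF assms(2) xy] by linarith
qed (rule lipschitz_on_nonneg[OF assms(1)])

lemma lipschitz_on_min:
  fixes f g :: "'a::metric_space \<Rightarrow> real"
  assumes "L-lipschitz_on A f" "L-lipschitz_on A g"
  shows "L-lipschitz_on A (\<lambda>x. min (f x) (g x))"
proof (rule lipschitz_on_realI)
  fix x y assume xy: "x \<in> A" "y \<in> A"
  show "min (f x) (g x) \<le> min (f y) (g y) + L * dist x y"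
    using lipschitz_on_realD[OF assms(1) xy] lipschitz_on_realD[OF assms(2) xy] by linarith
qed (rule lipschitz_on_nonneg[OF assms(1)])

lemma lipschitz_on_Max:
  fixes f :: "'i \<Rightarrow> 'a::metric_space \<Rightarrow> real"
  assumes "finite I" "I \<noteq> {}" and "\<And>i. i \<in> I \<Longrightarrow> L-lipschitz_on A (f i)"
  shows "L-lipschitz_on A (\<lambda>x. Max ((\<lambda>i. f i x) ` I))"
  using assms
proof (induction I rule: finite_ne_induct)
  case (insert i I)
  then show ?case by (auto intro!: lipschitz_on_max)
qed simp

lemma lipschitz_on_Min:
  fixes f :: "'i \<Rightarrow> 'a::metric_space \<Rightarrow> real"
  assumes "finite I" "I \<noteq> {}" and "\<And>i. i \<in> I \<Longrightarrow> L-lipschitz_on A (f i)"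
  shows "L-lipschitz_on A (\<lambda>x. Min ((\<lambda>i. f i x) ` I))"
  using assms
proof (induction I rule: finite_ne_induct)
  case (insert i I)
  then show ?case by (auto intro!: lipschitz_on_min)
qed simp

lemma lipschitz_on_const:
  "0 \<le> L \<Longrightarrow> L-lipschitz_on A (\<lambda>x. c)"
  by (rule lipschitz_onI) auto

lemma lipschitz_on_vec:
  fixes f :: "'a::metric_space \<Rightarrow> real ^ 'n"
  assumes "\<And>j. L-lipschitz_on A (\<lambda>x. f x $ j)"
  shows "(real CARD('n) * L)-lipschitz_on A f"
proof (rule lipschitz_onI)
  fix x y assume "x \<in> A" "y \<in> A"
  then have "\<bar>(f x - f y) $ j\<bar> \<le> L * dist x y" for j
    using lipschitz_onD[OF assms] by (simp add: dist_real_def)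
  then have "(\<Sum>j\<in>UNIV. \<bar>(f x - f y) $ j\<bar>) \<le> (\<Sum>j\<in>(UNIV :: 'n set). L * dist x y)"
    by (intro sum_mono)
  then show "dist (f x) (f y) \<le> real CARD('n) * L * dist x y"
    using norm_le_l1_cart[of "f x - f y"] by (simp add: dist_norm)
qed (simp add: lipschitz_on_nonneg[OF assms])

lemma lipschitz_on_scaleR:
  fixes f :: "'a::metric_space \<Rightarrow> real" and g :: "'a \<Rightarrow> 'b::real_normed_vector"
  assumes f: "L-lipschitz_on A f" "\<And>x. x \<in> A \<Longrightarrow> \<bar>f x\<bar> \<le> a" "0 \<le> a"
    and g: "M-lipschitz_on A g" "\<And>x. x \<in> A \<Longrightarrow> norm (g x) \<le> b" "0 \<le> b"
  shows "(a * M + b * L)-lipschitz_on A (\<lambda>x. f x *\<^sub>R g x)"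
proof (rule lipschitz_onI)
  fix x y assume xy: "x \<in> A" "y \<in> A"
  have "f x *\<^sub>R g x - f y *\<^sub>R g y = f x *\<^sub>R (g x - g y) + (f x - f y) *\<^sub>R g y"
    by (simp add: algebra_simps)
  then have "dist (f x *\<^sub>R g x) (f y *\<^sub>R g y)
      \<le> norm (f x *\<^sub>R (g x - g y)) + norm ((f x - f y) *\<^sub>R g y)"
    by (metis dist_norm norm_triangle_ineq)
  also have "\<dots> = \<bar>f x\<bar> * dist (g x) (g y) + norm (g y) * dist (f x) (f y)"
    by (simp add: dist_norm)
  also have "\<dots> \<le> a * (M * dist x y) + b * (L * dist x y)"
    using xy f g by (intro add_mono mult_mono lipschitz_onD) auto
  finally show "dist (f x *\<^sub>R g x) (f y *\<^sub>R g y) \<le> (a * M + b * L) * dist x y"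
    by (simp add: algebra_simps)
qed (use f(3) g(3) lipschitz_on_nonneg[OF f(1)] lipschitz_on_nonneg[OF g(1)] in auto)

text \<open>The factor 2 has two equal sources, the change of the vector and the change of its norm;
  each contributes at most \<open>norm (u - v) / norm u\<close>.\<close>

lemma lipschitz_on_sgn:
  fixes f :: "'a::metric_space \<Rightarrow> 'b::real_normed_vector"
  assumes f: "L-lipschitz_on A f" and "0 < \<delta>" and \<delta>: "\<And>x. x \<in> A \<Longrightarrow> \<delta> \<le> norm (f x)"
  shows "(2 * L / \<delta>)-lipschitz_on A (\<lambda>x. sgn (f x))"
proof (rule lipschitz_onI)
  fix x y assume xy: "x \<in> A" "y \<in> A"
  define u v where "u = f x" and "v = f y"
  have pos: "0 < norm u" "0 < norm v" "\<delta> \<le> norm u"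
    using \<delta> xy \<open>0 < \<delta>\<close> by (force simp: u_def v_def)+
  have "sgn u - sgn v = inverse (norm u) *\<^sub>R (u - v) + (inverse (norm u) - inverse (norm v)) *\<^sub>R v"
    by (simp add: sgn_div_norm algebra_simps)
  then have "norm (sgn u - sgn v)
      \<le> norm (inverse (norm u) *\<^sub>R (u - v)) + norm ((inverse (norm u) - inverse (norm v)) *\<^sub>R v)"
    by (metis norm_triangle_ineq)
  also have "\<dots> = norm (u - v) / norm u + \<bar>inverse (norm u) - inverse (norm v)\<bar> * norm v"
    by (simp add: divide_inverse)
  also have "\<bar>inverse (norm u) - inverse (norm v)\<bar> * norm v = \<bar>norm v - norm u\<bar> / norm u"
  proof -
    have "inverse (norm u) - inverse (norm v) = (norm v - norm u) / (norm u * norm v)"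
      using pos by (simp add: field_simps)
    then show ?thesis using pos by (simp add: abs_mult)
  qed
  also have "\<bar>norm v - norm u\<bar> / norm u \<le> norm (u - v) / norm u"
    using norm_triangle_ineq3[of v u] by (intro divide_right_mono) (auto simp: norm_minus_commute)
  also have "norm (u - v) / norm u + norm (u - v) / norm u = 2 * norm (u - v) / norm u" by simp
  also have "\<dots> \<le> 2 * norm (u - v) / \<delta>"
    using pos \<open>0 < \<delta>\<close> by (intro divide_left_mono) auto
  also have "\<dots> \<le> 2 * (L * dist x y) / \<delta>"
    using lipschitz_onD[OF f xy] \<open>0 < \<delta>\<close>
    by (intro divide_right_mono mult_left_mono) (auto simp: u_def v_def dist_norm)
  finally show "dist (sgn (f x)) (sgn (f y)) \<le> 2 * L / \<delta> * dist x y"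
    by (simp add: u_def v_def dist_norm)
qed (use lipschitz_on_nonneg[OF f] \<open>0 < \<delta>\<close> in simp)

section \<open>Extension of real-valued Lipschitz functions\<close>

lemma McShane_extension:
  fixes f :: "'a::metric_space \<Rightarrow> real"
  assumes f: "L-lipschitz_on A f"
  obtains F where "L-lipschitz_on B F" "\<And>x. x \<in> A \<Longrightarrow> F x = f x"
proof (cases "A = {}")
  case True
  then show ?thesis
    using that[of "\<lambda>_. 0"] lipschitz_on_nonneg[OF f] by (auto intro: lipschitz_on_const)
next
  case False
  then obtain a0 where a0: "a0 \<in> A" by blast
  have L: "0 \<le> L" by (rule lipschitz_on_nonneg[OF f])
  \<comment> \<open>An infimum of cones of slope \<open>L\<close> is \<open>L\<close>-Lipschitz on
    the whole type, so \<open>B\<close> can be arbitrary. Comparison with the fixed point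
    \<open>a0\<close> shows that the infimum is finite.\<close>
  define F where "F x = (INF a\<in>A. f a + L * dist x a)" for x
  have step: "L * dist x a \<le> L * dist y a + L * dist x y" for x y a :: 'a
    using mult_left_mono[OF dist_triangle[of x a y] L] by (simp add: algebra_simps)
  have bdd: "bdd_below ((\<lambda>a. f a + L * dist x a) ` A)" for x
  proof (rule bdd_belowI2[where m = "f a0 - L * dist a0 x"])
    fix a assume "a \<in> A"
    then show "f a0 - L * dist a0 x \<le> f a + L * dist x a"
      using lipschitz_on_realD[OF f a0] step[of a0 a x] by force
  qed
  have "F x \<le> F y + L * dist x y" for x y
  proof -
    have "F x - L * dist x y \<le> F y"
      unfolding F_def[of y]
    proof (rule cINF_greatest[OF False])
      fix a assume "a \<in> A"
      then have "F x \<le> f a + L * dist x a" unfolding F_def by (rule cINF_lower[OF bdd])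
      then show "F x - L * dist x y \<le> f a + L * dist y a" using step[of x a y] by linarith
    qed
    then show ?thesis by simp
  qed
  then have "L-lipschitz_on B F" using L by (intro lipschitz_on_realI)
  moreover have "F x = f x" if "x \<in> A" for x
  proof (rule antisym)
    show "F x \<le> f x" unfolding F_def using cINF_lower[OF bdd that, of x] by simp
    show "f x \<le> F x" unfolding F_def
      using lipschitz_on_realD[OF f that] by (intro cINF_greatest[OF False])
  qed
  ultimately show ?thesis by (rule that)
qed

lemma McShane_extension_bounded:
  fixes f :: "'a::metric_space \<Rightarrow> real"
  assumes f: "L-lipschitz_on A f" and b: "\<And>x. x \<in> A \<Longrightarrow> \<bar>f x\<bar> \<le> b" "0 \<le> b"
  obtains F where "L-lipschitz_on B F" "\<And>x. x \<in> A \<Longrightarrow> F x = f x" "\<And>x. \<bar>F x\<bar> \<le> b"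
proof -
  obtain F where F: "L-lipschitz_on B F" "\<And>x. x \<in> A \<Longrightarrow> F x = f x"
    using McShane_extension[OF f, where B = B] by blast
  show ?thesis
  proof (rule that[where F = "\<lambda>x. max (- b) (min b (F x))"])
    show "L-lipschitz_on B (\<lambda>x. max (- b) (min b (F x)))"
      using F lipschitz_on_nonneg[OF f]
      by (intro lipschitz_on_max lipschitz_on_min lipschitz_on_const)
    show "max (- b) (min b (F x)) = f x" if "x \<in> A" for x
      using F(2)[OF that] b(1)[OF that] by (auto simp: abs_le_iff max_def min_def)
    show "\<bar>max (- b) (min b (F x))\<bar> \<le> b" for x using b(2) by auto
  qed
qed

subsection \<open>Covers as labellings\<close>

text \<open>A colour class \<open>S\<close> is split into the fibres of a labelling \<open>p\<close>.\<close>

definition scattered :: "real \<Rightarrow> real \<Rightarrow> 'a::metric_space set \<Rightarrow> ('a \<Rightarrow> 'c) \<Rightarrow> bool" where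
  "scattered r D S p \<longleftrightarrow>
     (\<forall>x\<in>S. \<forall>y\<in>S. (p x = p y \<longrightarrow> dist x y \<le> D) \<and> (p x \<noteq> p y \<longrightarrow> r \<le> dist x y))"

text \<open>Using the hypothesis at scale \<open>r / a\<close> makes the separation exactly
  \<open>r\<close> and turns the constant into \<open>C / a\<close>. Only the fibres of the labels
  matter, so their type is left free; it is instantiated below with sets and with pairs.\<close>

lemma NA_dim_leI:
  fixes X :: "'a::metric_space set"
  assumes "0 < a" "0 < C"
    and col: "\<And>r. 0 < r \<Longrightarrow> \<exists>S (p :: nat \<Rightarrow> 'a \<Rightarrow> 'c).
      (\<Union>i\<in>{1..n+1}. S i) = X \<and> (\<forall>i\<in>{1..n+1}. scattered (a * r) (C * r) (S i) (p i))"
  shows "NA_dim_le X n"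
  unfolding NA_dim_le_def
proof (intro exI[of _ "C / a"] conjI allI impI)
  fix r :: real assume r: "0 < r"
  then have "0 < r / a" using \<open>0 < a\<close> by simp
  from col[OF this] obtain S and p :: "nat \<Rightarrow> 'a \<Rightarrow> 'c"
    where S: "(\<Union>i\<in>{1..n+1}. S i) = X"
      and "\<forall>i\<in>{1..n+1}. scattered (a * (r / a)) (C * (r / a)) (S i) (p i)"
    by blast
  then have sc: "\<And>i. i \<in> {1..n+1} \<Longrightarrow> scattered r (C / a * r) (S i) (p i)"
    using \<open>0 < a\<close> by simp
  \<comment> \<open>Labels that do not occur on \<open>S i\<close> contribute the empty set, of
    diameter 0; the fact \<open>D\<close> serves this case.\<close>
  define \<U> where "\<U> i = range (\<lambda>c. {x \<in> S i. p i x = c})" for i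
  have D: "0 \<le> C / a * r" using r assms by simp
  show "\<exists>\<U> :: nat \<Rightarrow> 'a set set.
        (\<forall>i\<in>{1..n+1}. \<U> i \<subseteq> Pow X \<and> r_disjoint r (\<U> i)) \<and>
        (\<Union>i\<in>{1..n+1}. \<Union>(\<U> i)) = X \<and>
        (\<forall>i\<in>{1..n+1}. \<forall>U\<in>\<U> i. bounded U \<and> diameter U \<le> C / a * r)"
  proof (intro exI[of _ \<U>] conjI ballI)
    fix i assume i: "i \<in> {1..n+1}"
    show "\<U> i \<subseteq> Pow X" using S i by (auto simp: \<U>_def)
    show "r_disjoint r (\<U> i)"
      unfolding r_disjoint_def
    proof (intro ballI impI)
      fix U V x y assume "U \<in> \<U> i" "V \<in> \<U> i" "U \<noteq> V" "x \<in> U" "y \<in> V"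
      then have "x \<in> S i" "y \<in> S i" "p i x \<noteq> p i y" by (auto simp: \<U>_def)
      then show "r \<le> dist x y" using sc[OF i] unfolding scattered_def by blast
    qed
    fix U assume "U \<in> \<U> i"
    then have le: "dist x y \<le> C / a * r" if "x \<in> U" "y \<in> U" for x y
      using sc[OF i] that unfolding scattered_def \<U>_def by auto
    show "bounded U" using le by (auto simp: bounded_two_points)
    show "diameter U \<le> C / a * r"
    proof (cases "U = {}")
      case False
      then show ?thesis using le unfolding diameter_def by (auto intro!: cSUP_least)
    qed (use D in simp)
  next
    show "(\<Union>i\<in>{1..n+1}. \<Union>(\<U> i)) = X"
      using S by (auto simp: \<U>_def)
  qed
qed (use assms in simp)

text \<open>Each point of a colour class is labelled by a member of the cover that contains it.
  Equal labels mean a common member, hence the diameter bound; different labels mean different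
  members, hence the separation.\<close>

lemma NA_dim_leE:
  fixes X :: "'a::metric_space set"
  assumes "NA_dim_le X n"
  obtains C where "0 < C"
    and "\<And>r. 0 < r \<Longrightarrow> \<exists>S (p :: nat \<Rightarrow> 'a \<Rightarrow> 'a set).
      (\<Union>i\<in>{1..n+1}. S i) = X \<and> (\<forall>i\<in>{1..n+1}. scattered r (C * r) (S i) (p i))"
proof -
  obtain C where C: "0 < C" and cov: "\<forall>r>0. \<exists>\<U> :: nat \<Rightarrow> 'a set set.
        (\<forall>i\<in>{1..n+1}. \<U> i \<subseteq> Pow X \<and> r_disjoint r (\<U> i)) \<and>
        (\<Union>i\<in>{1..n+1}. \<Union>(\<U> i)) = X \<and>
        (\<forall>i\<in>{1..n+1}. \<forall>U\<in>\<U> i. bounded U \<and> diameter U \<le> C * r)"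
    using assms unfolding NA_dim_le_def by (elim exE conjE) (rule that)
  show ?thesis
  proof (rule that[OF C])
    fix r :: real assume "0 < r"
    from cov[rule_format, OF this] obtain \<U> :: "nat \<Rightarrow> 'a set set"
      where \<U>: "\<forall>i\<in>{1..n+1}. \<U> i \<subseteq> Pow X \<and> r_disjoint r (\<U> i)"
        and X: "(\<Union>i\<in>{1..n+1}. \<Union>(\<U> i)) = X"
        and "\<forall>i\<in>{1..n+1}. \<forall>U\<in>\<U> i. bounded U \<and> diameter U \<le> C * r"
      by (elim exE conjE) (rule that)
    then have dis: "\<And>i. i \<in> {1..n+1} \<Longrightarrow> r_disjoint r (\<U> i)"
      and diam: "\<And>i U. i \<in> {1..n+1} \<Longrightarrow> U \<in> \<U> i \<Longrightarrow> bounded U \<and> diameter U \<le> C * r"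
      by blast+
    define p where "p i x = (SOME U. U \<in> \<U> i \<and> x \<in> U)" for i x
    have p: "p i x \<in> \<U> i \<and> x \<in> p i x" if "x \<in> \<Union>(\<U> i)" for i x
      unfolding p_def by (rule someI_ex) (use that in blast)
    have "scattered r (C * r) (\<Union>(\<U> i)) (p i)" if i: "i \<in> {1..n+1}" for i
      unfolding scattered_def
    proof (intro ballI conjI impI)
      fix x y assume x: "x \<in> \<Union>(\<U> i)" and y: "y \<in> \<Union>(\<U> i)"
      show "r \<le> dist x y" if "p i x \<noteq> p i y"
        using dis[OF i] p[OF x] p[OF y] that unfolding r_disjoint_def by blast
      show "dist x y \<le> C * r" if "p i x = p i y"
      proof -
        have "dist x y \<le> diameter (p i x)"
          using p[OF x] p[OF y] that diam[OF i] by (intro diameter_bounded_bound) auto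
        also have "\<dots> \<le> C * r" using diam[OF i] p[OF x] by blast
        finally show ?thesis .
      qed
    qed
    then show "\<exists>S (p :: nat \<Rightarrow> 'a \<Rightarrow> 'a set).
      (\<Union>i\<in>{1..n+1}. S i) = X \<and> (\<forall>i\<in>{1..n+1}. scattered r (C * r) (S i) (p i))"
      using X by (intro exI[of _ "\<lambda>i. \<Union>(\<U> i)"] exI[of _ p]) auto
  qed
qed

lemma NA_dim_le_mono:
  fixes X :: "'a::metric_space set"
  assumes "NA_dim_le X k" "k \<le> n"
  shows "NA_dim_le X n"
proof -
  obtain C where C: "0 < C"
    and cov: "\<And>r. 0 < r \<Longrightarrow> \<exists>S (p :: nat \<Rightarrow> 'a \<Rightarrow> 'a set).
      (\<Union>i\<in>{1..k+1}. S i) = X \<and> (\<forall>i\<in>{1..k+1}. scattered r (C * r) (S i) (p i))"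
    using NA_dim_leE[OF assms(1)] by blast
  show ?thesis
  proof (rule NA_dim_leI[where a = 1 and 'c = "'a set"])
    fix r :: real assume r: "0 < r"
    obtain S and p :: "nat \<Rightarrow> 'a \<Rightarrow> 'a set" where S: "(\<Union>i\<in>{1..k+1}. S i) = X"
      and p: "\<forall>i\<in>{1..k+1}. scattered r (C * r) (S i) (p i)"
      using cov[OF r] by blast
    \<comment> \<open>The additional colours are made empty, since \<open>S\<close> is unconstrained
      beyond \<open>k + 1\<close>.\<close>
    define S' where "S' i = {x \<in> S i. i \<le> k + 1}" for i
    have "{i \<in> {1..n+1}. i \<le> k + 1} = {1..k+1}" using assms(2) by auto
    moreover have "(\<Union>i\<in>{1..n+1}. S' i) = (\<Union>i\<in>{i \<in> {1..n+1}. i \<le> k + 1}. S i)"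
      unfolding S'_def by blast
    ultimately have "(\<Union>i\<in>{1..n+1}. S' i) = X" using S by simp
    moreover have "\<forall>i\<in>{1..n+1}. scattered (1 * r) (C * r) (S' i) (p i)"
    proof
      fix i assume "i \<in> {1..n+1}"
      then show "scattered (1 * r) (C * r) (S' i) (p i)"
        using p by (cases "i \<le> k + 1") (simp_all add: S'_def, simp add: scattered_def)
    qed
    ultimately show "\<exists>S (p :: nat \<Rightarrow> 'a \<Rightarrow> 'a set). (\<Union>i\<in>{1..n+1}. S i) = X \<and>
        (\<forall>i\<in>{1..n+1}. scattered (1 * r) (C * r) (S i) (p i))"
      by (intro exI[of _ S'] exI[of _ p] conjI)
  qed (use C in simp_all)
qed

subsection \<open>Extending maps into spheres\<close>

text \<open>On a cell \<open>F\<close> varies by at most \<epsilon>, so it is within 3 \<epsilon> of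
  a constant of absolute value at least \<epsilon>. The difference \<open>h\<close> varies like
  \<open>F\<close> inside a cell; between cells it changes by at most 6 \<epsilon> over a distance
  of at least \<open>r\<close>.\<close>

lemma perturb_away_from_zero:
  fixes F :: "'a::metric_space \<Rightarrow> real"
  assumes F: "L-lipschitz_on S F" and p: "scattered r D S p"
    and "0 < r" "0 < \<epsilon>" "L * D \<le> \<epsilon>"
  obtains h where "(L + 6 * \<epsilon> / r)-lipschitz_on X h"
    and "\<And>x. \<bar>h x\<bar> \<le> 3 * \<epsilon>"
    and "\<And>x. x \<in> S \<Longrightarrow> \<epsilon> \<le> \<bar>F x + h x\<bar>"
proof -
  have L: "0 \<le> L" by (rule lipschitz_on_nonneg[OF F])
  \<comment> \<open>\<open>k l\<close> is the value of \<open>F\<close> at a chosen point of the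
    cell \<open>l\<close>. If it is too small, \<open>c l\<close> replaces it by \<epsilon>, a move
    of at most 2 \<epsilon> whatever its sign.\<close>
  define k where "k l = F (SOME y. y \<in> S \<and> p y = l)" for l
  define c where "c l = (if \<epsilon> \<le> \<bar>k l\<bar> then k l else \<epsilon>)" for l
  have k: "\<bar>k (p x) - F x\<bar> \<le> \<epsilon>" if x: "x \<in> S" for x
  proof -
    define y where "y = (SOME y. y \<in> S \<and> p y = p x)"
    have y: "y \<in> S \<and> p y = p x"
      unfolding y_def by (rule someI_ex) (use x in blast)
    have "\<bar>F y - F x\<bar> \<le> L * dist y x"
      using lipschitz_onD[OF F, of y x] x y by (simp add: dist_real_def)
    also have "\<dots> \<le> L * D"
      using p x y L unfolding scattered_def by (intro mult_left_mono) auto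
    finally show ?thesis using assms(5) by (simp add: k_def y_def)
  qed
  have c: "\<epsilon> \<le> \<bar>c l\<bar>" "\<bar>c l - k l\<bar> \<le> 2 * \<epsilon>" for l
    using \<open>0 < \<epsilon>\<close> by (auto simp: c_def)
  have h_bound: "\<bar>c (p x) - F x\<bar> \<le> 3 * \<epsilon>" if "x \<in> S" for x
    using k[OF that] c(2)[of "p x"] by linarith
  have lip: "(L + 6 * \<epsilon> / r)-lipschitz_on S (\<lambda>x. c (p x) - F x)"
  proof (rule lipschitz_onI)
    fix x y assume x: "x \<in> S" and y: "y \<in> S"
    show "dist (c (p x) - F x) (c (p y) - F y) \<le> (L + 6 * \<epsilon> / r) * dist x y"
    proof (cases "p x = p y")
      case True
      then have "dist (c (p x) - F x) (c (p y) - F y) = dist (F x) (F y)"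
        by (simp add: dist_real_def)
      also have "\<dots> \<le> L * dist x y" by (rule lipschitz_onD[OF F x y])
      also have "\<dots> \<le> (L + 6 * \<epsilon> / r) * dist x y"
        using assms by (intro mult_right_mono) auto
      finally show ?thesis .
    next
      case False
      then have "r \<le> dist x y" using p x y unfolding scattered_def by blast
      then have "6 * \<epsilon> \<le> 6 * \<epsilon> / r * dist x y"
        using assms by (simp add: field_simps)
      moreover have "0 \<le> L * dist x y" using L by simp
      moreover have "dist (c (p x) - F x) (c (p y) - F y) \<le> 6 * \<epsilon>"
        using h_bound[OF x] h_bound[OF y] unfolding dist_real_def by linarith
      ultimately show ?thesis by (simp add: distrib_right)
    qed
  qed (use assms L in simp)
  obtain h where h: "(L + 6 * \<epsilon> / r)-lipschitz_on X h"
      "\<And>x. x \<in> S \<Longrightarrow> h x = c (p x) - F x" "\<And>x. \<bar>h x\<bar> \<le> 3 * \<epsilon>"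
  proof (rule McShane_extension_bounded[OF lip, where B = X and b = "3 * \<epsilon>"])
    show "\<bar>c (p x) - F x\<bar> \<le> 3 * \<epsilon>" if "x \<in> S" for x by (rule h_bound[OF that])
    show "0 \<le> 3 * \<epsilon>" using \<open>0 < \<epsilon>\<close> by simp
  qed (rule that)
  show ?thesis
    using h c(1) by (intro that[of h]) auto
qed

lemma NA_dim_le_imp_sphere_extensor:
  fixes X :: "'a::metric_space set"
  assumes dim: "NA_dim_le X n" and card: "CARD('n::finite) = n + 1"
  shows "lipschitz_extensor (sphere (0 :: real ^ 'n) 1) X"
proof -
  define N where "N = real CARD('n)"
  \<comment> \<open>Chosen so that \<open>N\<close> coordinates, each perturbed by at most 3
    \<epsilon>, give a perturbation of norm at most 1/4.\<close>
  define \<epsilon> where "\<epsilon> = 1 / (12 * N)"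
  have N: "1 \<le> N" by (simp add: N_def card)
  then have \<epsilon>: "0 < \<epsilon>" "\<epsilon> \<le> 1/4" "N * (3 * \<epsilon>) = 1/4"
    by (auto simp: \<epsilon>_def field_simps)
  obtain C where C: "0 < C" and cov: "\<And>r. 0 < r \<Longrightarrow> \<exists>S (p :: nat \<Rightarrow> 'a \<Rightarrow> 'a set).
      (\<Union>i\<in>{1..n+1}. S i) = X \<and> (\<forall>i\<in>{1..n+1}. scattered r (C * r) (S i) (p i))"
    using NA_dim_leE[OF dim] by blast
  obtain e :: "'n \<Rightarrow> nat" where e: "bij_betw e UNIV {1..n+1}"
    using finite_same_card_bij[of "UNIV :: 'n set" "{1..n+1}"] card by auto
  \<comment> \<open>\<open>N * (5/2 + 6 * C) * L\<close> will be the Lipschitz constant of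
    \<open>G\<close>; normalising a map of norm at least \<epsilon> multiplies it by 2 /
    \<epsilon>.\<close>
  define K where "K = 2 * (N * (5/2 + 6 * C)) / \<epsilon>"
  have K: "0 < K" using N C \<epsilon> by (simp add: K_def)
  show ?thesis
    unfolding lipschitz_extensor_def
  proof (intro exI[of _ K] conjI allI impI K, elim conjE)
    fix L A and f :: "'a \<Rightarrow> real ^ 'n"
    assume A: "A \<subseteq> X" and fA: "f ` A \<subseteq> sphere 0 1" and f: "L-lipschitz_on A f"
    have "0 \<le> L" by (rule lipschitz_on_nonneg[OF f])
    show "\<exists>g. g ` X \<subseteq> sphere 0 1 \<and> (K * L)-lipschitz_on X g \<and> (\<forall>x\<in>A. g x = f x)"
    \<comment> \<open>The scale \<open>r\<close> below divides by \<open>L\<close>. For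
      \<open>L = 0\<close> the map is constant on \<open>A\<close> and extends by that constant, or
      by any point of the sphere if \<open>A\<close> is empty.\<close>
    proof (cases "L = 0")
      case True
      obtain s where s: "s \<in> sphere (0 :: real ^ 'n) 1" "\<And>x. x \<in> A \<Longrightarrow> f x = s"
      proof (cases "A = {}")
        case True
        have "axis undefined 1 \<in> sphere (0 :: real ^ 'n) 1" by simp
        with True show ?thesis using that by blast
      next
        case False
        then obtain a where a: "a \<in> A" by blast
        have "f x = f a" if "x \<in> A" for x
          using lipschitz_onD[OF f that a] \<open>L = 0\<close> by simp
        with a fA show ?thesis using that[of "f a"] by blast
      qed
      then show ?thesis
        using True by (intro exI[of _ "\<lambda>_. s"]) (auto intro: lipschitz_on_const)
    next
      case False
      then have L: "0 < L" using \<open>0 \<le> L\<close> by simp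
      \<comment> \<open>At this scale a coordinate varies by at most \<epsilon> on a cell of
        diameter \<open>C * r\<close>, and the perturbation has slope proportional to
        \<open>L\<close>.\<close>
      define r where "r = \<epsilon> / (L * C)"
      have r: "0 < r" "6 * \<epsilon> / r = 6 * C * L" "L * (C * r) = \<epsilon>"
        using \<epsilon> L C by (auto simp: r_def field_simps)
      obtain S and p :: "nat \<Rightarrow> 'a \<Rightarrow> 'a set" where S: "(\<Union>i\<in>{1..n+1}. S i) = X"
        and p: "\<forall>i\<in>{1..n+1}. scattered r (C * r) (S i) (p i)"
        using cov[OF r(1)] by blast
      have "\<exists>F. L-lipschitz_on X F \<and> (\<forall>x\<in>A. F x = f x $ j)" for j
      proof -
        have "L-lipschitz_on A (\<lambda>x. f x $ j)"
          using \<open>0 \<le> L\<close> lipschitz_onD[OF f]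
          by (intro lipschitz_onI) (auto intro: order_trans[OF dist_vec_nth_le])
        then show ?thesis by (rule McShane_extension[where B = X]) blast
      qed
      then obtain F' where F': "\<And>j. L-lipschitz_on X (F' j)" "\<And>j x. x \<in> A \<Longrightarrow> F' j x = f x $ j"
        by metis
      have "\<exists>h. (L + 6 * \<epsilon> / r)-lipschitz_on X h \<and> (\<forall>x. \<bar>h x\<bar> \<le> 3 * \<epsilon>)
          \<and> (\<forall>x\<in>S (e j). \<epsilon> \<le> \<bar>F' j x + h x\<bar>)" for j
      proof -
        have ej: "e j \<in> {1..n+1}" using e by (auto simp: bij_betw_def)
        then have "S (e j) \<subseteq> X" using S by blast
        then have "L-lipschitz_on (S (e j)) (F' j)" using lipschitz_on_subset[OF F'(1)] by blast
        from perturb_away_from_zero[OF this p[rule_format, OF ej] r(1) \<epsilon>(1)] r(3)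
        show ?thesis by (metis order_refl)
      qed
      then obtain h where h: "\<And>j. (L + 6 * \<epsilon> / r)-lipschitz_on X (h j)"
          "\<And>j x. \<bar>h j x\<bar> \<le> 3 * \<epsilon>" "\<And>j x. x \<in> S (e j) \<Longrightarrow> \<epsilon> \<le> \<bar>F' j x + h j x\<bar>"
        by metis
      define F where "F x = (\<chi> j. F' j x)" for x
      define H where "H x = (\<chi> j. h j x)" for x
      \<comment> \<open>The cutoff is 1 where \<open>F\<close> has norm at most 1/2, and 0 where the
        norm is at least 1, in particular on \<open>A\<close>.\<close>
      define \<theta> where "\<theta> x = max 0 (min 1 (2 - 2 * norm (F x)))" for x
      define G where "G x = F x + \<theta> x *\<^sub>R H x" for x
      have lipF: "(N * L)-lipschitz_on X F"
        unfolding N_def using F'(1) by (intro lipschitz_on_vec) (simp add: F_def)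
      have lipH: "(N * (L + 6 * C * L))-lipschitz_on X H"
        unfolding N_def using h(1) r(2) by (intro lipschitz_on_vec) (simp add: H_def)
      have H: "norm (H x) \<le> 1/4" for x
      proof -
        have "norm (H x) \<le> (\<Sum>j\<in>UNIV. \<bar>H x $ j\<bar>)" by (rule norm_le_l1_cart)
        also have "\<dots> \<le> (\<Sum>j\<in>(UNIV :: 'n set). 3 * \<epsilon>)" using h(2) by (intro sum_mono) (simp add: H_def)
        also have "\<dots> = N * (3 * \<epsilon>)" by (simp add: N_def)
        finally show ?thesis using \<epsilon>(3) by simp
      qed
      have lip\<theta>: "(2 * (N * L))-lipschitz_on X \<theta>"
      proof -
        have "(2 * (N * L))-lipschitz_on X (\<lambda>x. 2 - 2 * norm (F x))"
        proof (rule lipschitz_on_realI)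
          fix x y assume "x \<in> X" "y \<in> X"
          then have "dist (F x) (F y) \<le> N * L * dist x y" by (rule lipschitz_onD[OF lipF])
          then show "2 - 2 * norm (F x) \<le> 2 - 2 * norm (F y) + 2 * (N * L) * dist x y"
            using norm_triangle_ineq2[of "F y" "F x"] by (simp add: dist_norm norm_minus_commute)
        qed (use N L in simp)
        then show ?thesis
          unfolding \<theta>_def using N L by (intro lipschitz_on_max lipschitz_on_min lipschitz_on_const) auto
      qed
      have \<theta>: "0 \<le> \<theta> x" "\<theta> x \<le> 1" for x by (auto simp: \<theta>_def)
      have "(N * L + (1 * (N * (L + 6 * C * L)) + 1/4 * (2 * (N * L))))-lipschitz_on X G"
        unfolding G_def using H \<theta>
        by (intro lipschitz_on_add lipF lipschitz_on_scaleR lip\<theta> lipH) auto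
      then have lipG: "(N * (5/2 + 6 * C) * L)-lipschitz_on X G" by (simp add: algebra_simps)
      \<comment> \<open>Where \<theta> is 1, the colour of \<open>x\<close> selects a coordinate of
        size at least \<epsilon>. Elsewhere \<open>F\<close> has norm above 1/2 and loses at most
        1/4.\<close>
      have G: "\<epsilon> \<le> norm (G x)" if "x \<in> X" for x
      proof (cases "norm (F x) \<le> 1/2")
        case True
        then have "\<theta> x = 1" by (simp add: \<theta>_def)
        obtain i where i: "i \<in> {1..n+1}" "x \<in> S i" using \<open>x \<in> X\<close> S by blast
        obtain j where "e j = i" using e i(1) by (metis bij_betw_imp_surj_on imageE)
        then have "\<epsilon> \<le> \<bar>F' j x + h j x\<bar>" using h(3) i(2) by blast
        also have "\<dots> = \<bar>G x $ j\<bar>" using \<open>\<theta> x = 1\<close> by (simp add: G_def F_def H_def)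
        also have "\<dots> \<le> norm (G x)" by (rule component_le_norm_cart)
        finally show ?thesis .
      next
        case False
        have "norm (\<theta> x *\<^sub>R H x) \<le> 1 * (1/4)"
          unfolding norm_scaleR using \<theta> H by (intro mult_mono) auto
        moreover have "norm (F x) \<le> norm (G x) + norm (\<theta> x *\<^sub>R H x)"
          unfolding G_def by (metis add_diff_cancel norm_triangle_ineq4)
        ultimately show ?thesis using False \<epsilon>(2) by linarith
      qed
      have GA: "G x = f x" if "x \<in> A" for x
      proof -
        have "F x = f x" using F'(2)[OF that] by (simp add: F_def vec_eq_iff)
        moreover have "norm (f x) = 1" using fA that by auto
        ultimately show ?thesis by (simp add: G_def \<theta>_def)
      qed
      show ?thesis
      proof (intro exI[of _ "\<lambda>x. sgn (G x)"] conjI ballI)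
        show "(\<lambda>x. sgn (G x)) ` X \<subseteq> sphere 0 1"
          using G \<epsilon>(1) by (force simp: norm_sgn)
        show "(K * L)-lipschitz_on X (\<lambda>x. sgn (G x))"
          using lipschitz_on_sgn[OF lipG \<epsilon>(1) G] by (simp add: K_def mult_ac)
        fix x assume "x \<in> A"
        then have "norm (f x) = 1" using fA by auto
        then show "sgn (G x) = f x" using GA[OF \<open>x \<in> A\<close>] by (simp add: sgn_div_norm)
      qed
    qed
  qed
qed

subsection \<open>Lowering the dimension\<close>

lemma scattered_mono:
  assumes "scattered r D S p" "T \<subseteq> S" "r' \<le> r" "D \<le> D'"
  shows "scattered r' D' T p"
  unfolding scattered_def
proof (intro ballI conjI impI)
  fix x y assume "x \<in> T" "y \<in> T"
  then have "x \<in> S" "y \<in> S" using assms(2) by auto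
  then have *: "p x = p y \<Longrightarrow> dist x y \<le> D" "p x \<noteq> p y \<Longrightarrow> r \<le> dist x y"
    using assms(1) unfolding scattered_def by blast+
  show "p x = p y \<Longrightarrow> dist x y \<le> D'" using *(1) assms(4) by linarith
  show "p x \<noteq> p y \<Longrightarrow> r' \<le> dist x y" using *(2) assms(3) by linarith
qed

section \<open>Bump functions subordinate to a cover\<close>

lemma NA_dim_le_bumps:
  fixes X :: "'a::metric_space set"
  assumes "NA_dim_le X n"
  obtains C where "0 < C"
    and "\<And>r. 0 < r \<Longrightarrow> \<exists>\<phi> (p :: nat \<Rightarrow> 'a \<Rightarrow> 'a set).
      (\<forall>i. (4 / r)-lipschitz_on X (\<phi> i)) \<and> (\<forall>i x. 0 \<le> \<phi> i x \<and> \<phi> i x \<le> (1::real)) \<and>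
      (\<forall>x\<in>X. \<exists>i\<in>{1..n+1}. \<phi> i x = 1) \<and>
      (\<forall>i\<in>{1..n+1}. scattered (1/2 * r) (C * r) {x\<in>X. 0 < \<phi> i x} (p i))"
proof -
  obtain C where C: "0 < C" and cov: "\<And>r. 0 < r \<Longrightarrow> \<exists>S (p :: nat \<Rightarrow> 'a \<Rightarrow> 'a set).
      (\<Union>i\<in>{1..n+1}. S i) = X \<and> (\<forall>i\<in>{1..n+1}. scattered r (C * r) (S i) (p i))"
    using NA_dim_leE[OF assms] by blast
  show ?thesis
  proof (rule that[of "C + 1/2"])
    show "0 < C + 1/2" using C by simp
    fix r :: real assume r: "0 < r"
    obtain S and p :: "nat \<Rightarrow> 'a \<Rightarrow> 'a set" where S: "(\<Union>i\<in>{1..n+1}. S i) = X"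
      and p: "\<forall>i\<in>{1..n+1}. scattered r (C * r) (S i) (p i)"
      using cov[OF r] by blast
    \<comment> \<open>The empty colour class is treated apart because \<open>infdist\<close> to the
      empty set is 0, which would give the constant 1.\<close>
    define \<phi> where "\<phi> i x = (if S i = {} then 0 else max 0 (1 - 4 / r * infdist x (S i)))" for i x
    \<comment> \<open>A point of the support inherits the label of a point of \<open>S i\<close>
      closer than \<open>r / 4\<close>. Two such moves cost \<open>r / 2\<close>, both in separation
      and in diameter.\<close>
    define s where "s i x = (SOME u. u \<in> S i \<and> dist x u < r / 4)" for i x
    have s: "s i x \<in> S i \<and> dist x (s i x) < r / 4" if "0 < \<phi> i x" for i x
      unfolding s_def
    proof (rule someI_ex)
      have ne: "S i \<noteq> {}" and "0 < 1 - 4 / r * infdist x (S i)"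
        using that by (auto simp: \<phi>_def split: if_splits)
      then have "infdist x (S i) < r / 4" using r by (simp add: field_simps)
      then show "\<exists>u. u \<in> S i \<and> dist x u < r / 4"
        unfolding infdist_notempty[OF ne] using cINF_greatest[OF ne, of "r / 4" "dist x"] by force
    qed
    show "\<exists>\<phi> (p :: nat \<Rightarrow> 'a \<Rightarrow> 'a set).
      (\<forall>i. (4 / r)-lipschitz_on X (\<phi> i)) \<and> (\<forall>i x. 0 \<le> \<phi> i x \<and> \<phi> i x \<le> (1::real)) \<and>
      (\<forall>x\<in>X. \<exists>i\<in>{1..n+1}. \<phi> i x = 1) \<and>
      (\<forall>i\<in>{1..n+1}. scattered (1/2 * r) ((C + 1/2) * r) {x\<in>X. 0 < \<phi> i x} (p i))"
    proof (intro exI[of _ \<phi>] exI[of _ "\<lambda>i x. p i (s i x)"] conjI allI ballI)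
      fix i
      have "(4 / r)-lipschitz_on X (\<lambda>x. 1 - 4 / r * infdist x (S i))"
      proof (rule lipschitz_on_realI)
        fix x y assume "x \<in> X" "y \<in> X"
        have "4 / r * infdist y (S i) \<le> 4 / r * (infdist x (S i) + dist x y)"
          using r infdist_triangle[of y "S i" x] by (intro mult_left_mono) (auto simp: dist_commute)
        then show "1 - 4 / r * infdist x (S i) \<le> 1 - 4 / r * infdist y (S i) + 4 / r * dist x y"
          by (simp add: distrib_left)
      qed (use r in simp)
      then show "(4 / r)-lipschitz_on X (\<phi> i)"
        unfolding \<phi>_def using r
        by (cases "S i = {}") (auto intro!: lipschitz_on_max intro: lipschitz_on_const)
    next
      fix i x show "0 \<le> \<phi> i x" "\<phi> i x \<le> 1" using r by (auto simp: \<phi>_def infdist_nonneg)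
    next
      fix x assume "x \<in> X"
      then obtain i where i: "i \<in> {1..n+1}" "x \<in> S i" using S by blast
      then have "\<phi> i x = 1" by (auto simp: \<phi>_def)
      then show "\<exists>i\<in>{1..n+1}. \<phi> i x = 1" using i(1) by blast
    next
      fix i assume i: "i \<in> {1..n+1}"
      show "scattered (1/2 * r) ((C + 1/2) * r) {x\<in>X. 0 < \<phi> i x} (\<lambda>x. p i (s i x))"
        unfolding scattered_def
      proof (intro ballI conjI impI)
        fix x y assume "x \<in> {x\<in>X. 0 < \<phi> i x}" "y \<in> {x\<in>X. 0 < \<phi> i x}"
        then have sx: "s i x \<in> S i" "dist x (s i x) < r / 4" and sy: "s i y \<in> S i" "dist y (s i y) < r / 4"
          using s by blast+
        have tri: "dist x y \<le> dist x (s i x) + dist (s i x) (s i y) + dist y (s i y)"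
          "dist (s i x) (s i y) \<le> dist x (s i x) + dist x y + dist y (s i y)"
          by metric+
        show "dist x y \<le> (C + 1/2) * r" if "p i (s i x) = p i (s i y)"
        proof -
          have "dist (s i x) (s i y) \<le> C * r"
            using p i sx sy that unfolding scattered_def by blast
          then show ?thesis using tri(1) sx sy by (simp add: distrib_right)
        qed
        show "1/2 * r \<le> dist x y" if "p i (s i x) \<noteq> p i (s i y)"
        proof -
          have "r \<le> dist (s i x) (s i y)"
            using p i sx sy that unfolding scattered_def by blast
          then show ?thesis using tri(2) sx sy by simp
        qed
      qed
    qed
  qed
qed

section \<open>Gaps between function values, and the colourings they define\<close>

lemma exists_gap:
  fixes g :: "'i \<Rightarrow> real"
  assumes fin: "finite I" and card: "card I \<le> m" "0 < m" and "0 < c"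
    and nonneg: "\<And>i. i \<in> I \<Longrightarrow> 0 \<le> g i"
    and zero: "i0 \<in> I" "g i0 = 0" and max: "i1 \<in> I" "c \<le> g i1"
  obtains T where "T \<subseteq> I" "T \<noteq> {}" "T \<noteq> I" "\<And>i j. i \<in> T \<Longrightarrow> j \<in> I - T \<Longrightarrow> g j + c / m \<le> g i"
proof -
  define \<gamma> where "\<gamma> = c / real m"
  have \<gamma>: "0 < \<gamma>" "real m * \<gamma> = c" using assms by (auto simp: \<gamma>_def)
  define b where "b i = nat \<lfloor>g i / \<gamma>\<rfloor>" for i
  have "card (b ` (I - {i0})) \<le> card (I - {i0})" using fin by (intro card_image_le) auto
  also have "\<dots> < m"
    using card_Diff1_less[OF fin zero(1)] card(1) by linarith
  \<comment> \<open>Pigeonhole: the indices other than \<open>i0\<close> are fewer than the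
    \<open>m\<close> intervals of length \<gamma> that make up \<open>[0, c)\<close>, so some
    interval contains none of their values. The value 0 at \<open>i0\<close> lies at or below its
    lower end, even for \<open>k = 0\<close>.\<close>
  finally have "\<not> {..<m} \<subseteq> b ` (I - {i0})"
    using card_mono[of "b ` (I - {i0})" "{..<m}"] fin by auto
  then obtain k where k: "k < m" "\<And>i. i \<in> I - {i0} \<Longrightarrow> b i \<noteq> k" by blast
  define T where "T = {i \<in> I. real (k + 1) * \<gamma> \<le> g i}"
  have low: "g j \<le> real k * \<gamma>" if "j \<in> I - T" for j
  proof (cases "j = i0")
    case False
    have "g j < real (k + 1) * \<gamma>" using that by (auto simp: T_def)
    then have "g j / \<gamma> < real (k + 1)" using \<gamma>(1) by (simp add: field_simps)
    then have "\<lfloor>g j / \<gamma>\<rfloor> < int (k + 1)" by (simp add: floor_less_iff)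
    moreover have "0 \<le> \<lfloor>g j / \<gamma>\<rfloor>" using nonneg that \<gamma>(1) by simp
    moreover have "b j \<noteq> k" using k(2) that False by blast
    ultimately have "\<lfloor>g j / \<gamma>\<rfloor> < int k" unfolding b_def by linarith
    then have "g j / \<gamma> < real k" by (simp add: floor_less_iff)
    then show ?thesis using \<gamma>(1) by (simp add: field_simps)
  qed (use zero \<gamma> in simp)
  have "real (k + 1) * \<gamma> \<le> real m * \<gamma>" using k(1) \<gamma>(1) by (intro mult_right_mono) auto
  then have "i1 \<in> T" using max \<gamma>(2) by (simp add: T_def)
  moreover have "i0 \<notin> T" using zero \<gamma>(1) by (simp add: T_def mult_le_0_iff)
  moreover have "g j + c / m \<le> g i" if "i \<in> T" "j \<in> I - T" for i j
    using low[OF that(2)] that(1) by (simp add: T_def \<gamma>_def[symmetric] distrib_right)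
  ultimately show ?thesis using zero(1) by (intro that[of T]) (auto simp: T_def)
qed

text \<open>The colour of a point is the number \<open>j\<close> of indices above a gap in the values \<open>g i x\<close>, and its
  label consists of the set \<open>T\<close> of these indices and the cell of the function \<open>g (Min T)\<close>.\<close>

lemma NA_dim_le_of_functions:
  fixes X :: "'a::metric_space set"
  assumes "0 < a" "0 < C" "0 < K" "0 < c"
    and fns: "\<And>r. 0 < r \<Longrightarrow> \<exists>g (p :: nat \<Rightarrow> 'a \<Rightarrow> 'c).
      (\<forall>i\<in>{1..k+2}. (K / r)-lipschitz_on X (g i) \<and> (\<forall>x\<in>X. (0::real) \<le> g i x) \<and>
         scattered (a * r) (C * r) {x\<in>X. 0 < g i x} (p i)) \<and>
      (\<forall>x\<in>X. (\<exists>i\<in>{1..k+2}. g i x = 0) \<and> (\<exists>i\<in>{1..k+2}. c \<le> g i x))"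
  shows "NA_dim_le X k"
proof -
  define \<gamma> where "\<gamma> = c / real (k + 2)"
  have \<gamma>: "0 < \<gamma>" using \<open>0 < c\<close> by (simp add: \<gamma>_def)
  define I where "I = {1..k+2}"
  show ?thesis
  proof (rule NA_dim_leI[where a = "min a (\<gamma> / K)" and C = C and 'c = "nat set \<times> 'c"])
    show "0 < min a (\<gamma> / K)" using assms \<gamma> by simp
    fix r :: real assume r: "0 < r"
    obtain g and p :: "nat \<Rightarrow> 'a \<Rightarrow> 'c" where
      g: "\<forall>i\<in>I. (K / r)-lipschitz_on X (g i) \<and> (\<forall>x\<in>X. (0::real) \<le> g i x) \<and>
            scattered (a * r) (C * r) {x\<in>X. 0 < g i x} (p i)"
      and g': "\<forall>x\<in>X. (\<exists>i\<in>I. g i x = 0) \<and> (\<exists>i\<in>I. c \<le> g i x)"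
      using fns[OF r, folded I_def] by (elim exE conjE) (rule that)
    define top where "top j x T \<longleftrightarrow> T \<subseteq> I \<and> card T = j \<and> (\<forall>i\<in>T. \<forall>i'\<in>I-T. g i' x + \<gamma> \<le> g i x)" for j x T
    define S where "S j = {x \<in> X. \<exists>T. top j x T}" for j
    define t where "t j x = (SOME T. top j x T)" for j x
    have t: "top j x (t j x)" if "x \<in> S j" for j x
      unfolding t_def by (rule someI_ex) (use that in \<open>simp add: S_def\<close>)
    have cover: "(\<Union>j\<in>{1..k+1}. S j) = X"
    proof
      show "X \<subseteq> (\<Union>j\<in>{1..k+1}. S j)"
      proof
        fix x assume x: "x \<in> X"
        obtain i0 i1 where i: "i0 \<in> I" "g i0 x = 0" "i1 \<in> I" "c \<le> g i1 x" using g' x by blast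
        obtain T where T: "T \<subseteq> I" "T \<noteq> {}" "T \<noteq> I"
          "\<And>i j. i \<in> T \<Longrightarrow> j \<in> I - T \<Longrightarrow> g j x + c / real (k + 2) \<le> g i x"
          using exists_gap[of I "k + 2" c "\<lambda>i. g i x" i0 i1] i g x \<open>0 < c\<close> unfolding I_def
          by auto
        have "card T < card I" using T by (intro psubset_card_mono) (auto simp: I_def)
        moreover have "card T \<noteq> 0" using T finite_subset[OF T(1)] by (auto simp: I_def)
        ultimately have "card T \<in> {1..k+1}" by (simp add: I_def)
        moreover have "top (card T) x T" using T by (simp add: top_def \<gamma>_def)
        ultimately show "x \<in> (\<Union>j\<in>{1..k+1}. S j)" using x unfolding S_def by blast
      qed
    qed (auto simp: S_def)
    have "scattered (min a (\<gamma> / K) * r) (C * r) (S j) (\<lambda>x. (t j x, p (Min (t j x)) x))"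
      if j: "j \<in> {1..k+1}" for j
      unfolding scattered_def
    proof (intro ballI conjI impI)
      fix x y assume x: "x \<in> S j" and y: "y \<in> S j"
      have X: "x \<in> X" "y \<in> X" using x y by (auto simp: S_def)
      \<comment> \<open>As \<open>j \<le> k + 1\<close>, some index lies outside
        \<open>t j w\<close>; its function is nonnegative, and those in \<open>t j w\<close> exceed
        it by \<gamma>. So \<open>w\<close> lies in the support whose cell is used as label.\<close>
      have pos: "Min (t j w) \<in> t j w \<and> Min (t j w) \<in> I \<and> 0 < g (Min (t j w)) w" if "w \<in> S j" for w
      proof -
        have T: "t j w \<subseteq> I" "card (t j w) = j" "\<forall>i\<in>t j w. \<forall>i'\<in>I - t j w. g i' w + \<gamma> \<le> g i w"
          using t[OF that] by (auto simp: top_def)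
        have "t j w \<noteq> {}" using T(2) j by auto
        moreover have "finite (t j w)" using T(1) finite_subset by (auto simp: I_def)
        ultimately have *: "Min (t j w) \<in> t j w" by simp
        have "t j w \<noteq> I" using T(2) j by (auto simp: I_def)
        then obtain i' where i': "i' \<in> I - t j w" using T(1) by blast
        then have "0 \<le> g i' w" using g that by (auto simp: S_def)
        then have "0 < g (Min (t j w)) w" using T(3) * i' \<gamma> by force
        then show ?thesis using * T(1) by blast
      qed
      show "dist x y \<le> C * r" if "(t j x, p (Min (t j x)) x) = (t j y, p (Min (t j y)) y)"
        using that g pos[OF x] pos[OF y] X unfolding scattered_def by auto
      show "min a (\<gamma> / K) * r \<le> dist x y" if ne: "(t j x, p (Min (t j x)) x) \<noteq> (t j y, p (Min (t j y)) y)"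
      proof (cases "t j x = t j y")
        case True
        then have "a * r \<le> dist x y"
          using ne g pos[OF x] pos[OF y] X unfolding scattered_def by auto
        moreover have "min a (\<gamma> / K) * r \<le> a * r" using r by (intro mult_right_mono) auto
        ultimately show ?thesis by linarith
      next
        case False
        have T: "t j x \<subseteq> I" "card (t j x) = j" "\<forall>i\<in>t j x. \<forall>i'\<in>I - t j x. g i' x + \<gamma> \<le> g i x"
          "t j y \<subseteq> I" "card (t j y) = j" "\<forall>i\<in>t j y. \<forall>i'\<in>I - t j y. g i' y + \<gamma> \<le> g i y"
          using t[OF x] t[OF y] by (auto simp: top_def)
        have fin: "finite (t j x)" "finite (t j y)"
          using T(1,4) finite_subset by (auto simp: I_def)
        \<comment> \<open>Different sets of equal size are not nested. Two indices \<open>i\<close>,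
          \<open>i'\<close> thus change order across the gap between \<open>x\<close> and
          \<open>y\<close>, which forces a distance of at least
          \<open>\<gamma> / K * r\<close>.\<close>
        have "\<not> t j x \<subseteq> t j y" "\<not> t j y \<subseteq> t j x"
          using False T(2,5) card_subset_eq fin by metis+
        then obtain i i' where i: "i \<in> t j x" "i \<notin> t j y" "i' \<in> t j y" "i' \<notin> t j x" by blast
        then have "g i' x + \<gamma> \<le> g i x" "g i y + \<gamma> \<le> g i' y" "i \<in> I" "i' \<in> I"
          using T by auto
        moreover have "g i x \<le> g i y + K / r * dist x y" "g i' y \<le> g i' x + K / r * dist y x"
          using g X \<open>i \<in> I\<close> \<open>i' \<in> I\<close> lipschitz_on_realD[of "K / r" X] by blast+
        ultimately have "\<gamma> \<le> K / r * dist x y" by (simp add: dist_commute)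
        then have "\<gamma> / K * r \<le> dist x y" using r \<open>0 < K\<close> by (simp add: field_simps)
        moreover have "min a (\<gamma> / K) * r \<le> \<gamma> / K * r" using r by (intro mult_right_mono) auto
        ultimately show ?thesis by linarith
      qed
    qed
    then show "\<exists>S (p :: nat \<Rightarrow> 'a \<Rightarrow> nat set \<times> 'c).
      (\<Union>i\<in>{1..k+1}. S i) = X \<and> (\<forall>i\<in>{1..k+1}. scattered (min a (\<gamma> / K) * r) (C * r) (S i) (p i))"
      using cover by (intro exI[of _ S] exI[of _ "\<lambda>j x. (t j x, p (Min (t j x)) x)"]) auto
  qed (fact \<open>0 < C\<close>)
qed

section \<open>Pushing the bump functions to minimum zero\<close>

lemma sphere_extensor_imp_NA_dim_drop:
  fixes X :: "'a::metric_space set"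
  assumes ext: "lipschitz_extensor (sphere (0 :: real ^ 'n) 1) X"
    and card: "CARD('n::finite) = n + 1" and "n \<le> k" and dim: "NA_dim_le X (k + 1)"
  shows "NA_dim_le X k"
proof -
  define N where "N = real CARD('n)"
  have N: "1 \<le> N" by (simp add: N_def card)
  obtain C' where "0 < C'" and ext': "\<And>L A f. A \<subseteq> X \<Longrightarrow> f ` A \<subseteq> sphere (0 :: real ^ 'n) 1 \<Longrightarrow>
      L-lipschitz_on A f \<Longrightarrow>
      \<exists>g. g ` X \<subseteq> sphere 0 1 \<and> (C' * L)-lipschitz_on X g \<and> (\<forall>x\<in>A. g x = f x)"
    using ext unfolding lipschitz_extensor_def by metis
  obtain C where C: "0 < C" and bumps: "\<And>r. 0 < r \<Longrightarrow> \<exists>\<phi> (p :: nat \<Rightarrow> 'a \<Rightarrow> 'a set).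
      (\<forall>i. (4 / r)-lipschitz_on X (\<phi> i)) \<and> (\<forall>i x. 0 \<le> \<phi> i x \<and> \<phi> i x \<le> (1::real)) \<and>
      (\<forall>x\<in>X. \<exists>i\<in>{1..k+1+1}. \<phi> i x = 1) \<and>
      (\<forall>i\<in>{1..k+1+1}. scattered (1/2 * r) (C * r) {x\<in>X. 0 < \<phi> i x} (p i))"
    by (rule NA_dim_le_bumps[OF dim]) (rule that)
  obtain e :: "'n \<Rightarrow> nat" where e: "bij_betw e UNIV {1..n+1}"
    using finite_same_card_bij[of "UNIV :: 'n set" "{1..n+1}"] card by auto
  define z where "z = n + 2"
  define I where "I = {1..n+2}"
  have I: "finite I" "I \<noteq> {}" "z \<in> I" by (auto simp: I_def z_def)
  have eI: "e j \<in> I" "e j \<noteq> z" for j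
    using bij_betw_apply[OF e, of j] by (auto simp: I_def z_def)
  have I_cases: "i = z \<or> (\<exists>j. i = e j)" if "i \<in> I" for i
  proof (cases "i = z")
    case False
    then have "i \<in> range e" using that e by (auto simp: I_def z_def bij_betw_def)
    then show ?thesis by blast
  qed simp
  \<comment> \<open>\<open>y\<close> lists the coordinates of \<open>v\<close> with an extra zero at index \<open>z\<close>; subtracting the minimum
    inverts the map \<open>\<psi>\<close> below on vectors whose minimum is \<open>0\<close>.\<close>
  define y where "y i v = (if i = z then 0 else v $ inv e i)" for i and v :: "real ^ 'n"
  have y_e: "y (e j) v = v $ j" for j v
    using eI(2) e by (simp add: y_def bij_betw_def inv_f_f)
  have y_z: "y z v = 0" for v by (simp add: y_def)
  have y_le: "\<bar>y i v\<bar> \<le> norm v" for i v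
    by (simp add: y_def component_le_norm_cart)
  have y_sgn: "y i (sgn v) = y i v / norm v" for i v
    by (simp add: y_def sgn_div_norm divide_inverse)
  \<comment> \<open>The product of \<rho> and \<tau> will have slope
    \<open>L + 2 * \<kappa>\<close>, where \<open>L\<close> is the Lipschitz constant of the
    extension \<open>f\<close>; the final 4 comes from \<open>\<kappa> = 4 / r\<close>.\<close>
  define K where "K = (C' * (16 * N) + 2) * 4"
  show ?thesis
  proof (rule NA_dim_le_of_functions[where a = "1/2" and C = C and K = K and c = "1 / (2 * N)" and 'c = "'a set"])
    show "0 < K" using N \<open>0 < C'\<close> by (simp add: K_def add_pos_pos)
    show "0 < 1 / (2 * N)" using N by simp
    fix r :: real assume r: "0 < r"
    define \<kappa> where "\<kappa> = 4 / r"
    have \<kappa>: "0 < \<kappa>" using r by (simp add: \<kappa>_def)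
    obtain \<phi> and p :: "nat \<Rightarrow> 'a \<Rightarrow> 'a set" where
      lip\<phi>: "\<forall>i. \<kappa>-lipschitz_on X (\<phi> i)" and \<phi>: "\<forall>i x. 0 \<le> \<phi> i x \<and> \<phi> i x \<le> (1::real)" and
      one: "\<forall>x\<in>X. \<exists>i\<in>{1..k+1+1}. \<phi> i x = 1" and
      p: "\<forall>i\<in>{1..k+1+1}. scattered (1/2 * r) (C * r) {x\<in>X. 0 < \<phi> i x} (p i)"
      using bumps[OF r, folded \<kappa>_def] by (elim exE conjE) (rule that)
    define M where "M x = Max ((\<lambda>i. \<phi> i x) ` I)" for x
    have M_ge: "\<phi> i x \<le> M x" if "i \<in> I" for i x
      unfolding M_def using that I by (intro Max_ge) auto
    have M_le: "M x \<le> 1" for x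
      unfolding M_def using I \<phi> by (intro Max.boundedI) auto
    have lipM: "\<kappa>-lipschitz_on X M"
      unfolding M_def using I lip\<phi> by (intro lipschitz_on_Max) auto
    \<comment> \<open>A radial factor replacing the norm lost by normalisation: it vanishes unless
      some bump in \<open>I\<close> exceeds 1/2, and equals 1/2 where one of them is 1.\<close>
    define \<rho> where "\<rho> x = max 0 (M x - 1/2)" for x
    have \<rho>: "0 \<le> \<rho> x" "\<rho> x \<le> 1/2" for x using M_le[of x] by (auto simp: \<rho>_def max_def)
    have lip\<rho>: "\<kappa>-lipschitz_on X \<rho>"
    proof -
      have "\<kappa>-lipschitz_on X (\<lambda>x. M x - 1/2)"
        using lipschitz_on_diff[OF lipM lipschitz_on_constant[of X "1/2"]] by simp
      then show ?thesis unfolding \<rho>_def using \<kappa> by (intro lipschitz_on_max lipschitz_on_const) auto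
    qed
    define \<psi> where "\<psi> x = (\<chi> j. \<phi> (e j) x - \<phi> z x)" for x
    have "(\<kappa> + \<kappa>)-lipschitz_on X (\<lambda>x. \<psi> x $ j)" for j
      unfolding \<psi>_def vec_lambda_beta using lip\<phi> by (intro lipschitz_on_diff) auto
    then have lip\<psi>: "(N * (\<kappa> + \<kappa>))-lipschitz_on X \<psi>"
      unfolding N_def by (rule lipschitz_on_vec)
    have y_\<psi>: "y i (\<psi> x) = \<phi> i x - \<phi> z x" if "i \<in> I" for i x
      using I_cases[OF that] by (auto simp: y_e y_z \<psi>_def)
    \<comment> \<open>Here the direction of \<psi> is prescribed. At other points either all bumps
      in \<open>I\<close> are positive, so no support can grow, or \<rho> vanishes.\<close>
    define A where "A = {x \<in> X. 1/2 \<le> M x \<and> (\<exists>i\<in>I. \<phi> i x = 0)}"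
    \<comment> \<open>Two entries of the list \<open>y\<close> differ by at least 1/2, and both are
      bounded by the norm.\<close>
    have norm_\<psi>: "1/4 \<le> norm (\<psi> x)" if x: "x \<in> A" for x
    proof -
      obtain i where i: "i \<in> I" "\<phi> i x = 0" using x by (auto simp: A_def)
      have "M x \<in> (\<lambda>i. \<phi> i x) ` I" unfolding M_def using I by (intro Max_in) auto
      then obtain i' where i': "i' \<in> I" "1/2 \<le> \<phi> i' x" using x by (auto simp: A_def)
      show ?thesis
        using y_le[of i "\<psi> x"] y_le[of i' "\<psi> x"] y_\<psi>[OF i(1), of x] y_\<psi>[OF i'(1), of x]
          i(2) i'(2) by linarith
    qed
    have "A \<subseteq> X" by (auto simp: A_def)
    have "(2 * (N * (\<kappa> + \<kappa>)) / (1/4))-lipschitz_on A (\<lambda>x. sgn (\<psi> x))"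
      using norm_\<psi> by (intro lipschitz_on_sgn lipschitz_on_subset[OF lip\<psi> \<open>A \<subseteq> X\<close>]) auto
    moreover have "2 * (N * (\<kappa> + \<kappa>)) / (1/4) = 16 * N * \<kappa>" by simp
    ultimately have "(16 * N * \<kappa>)-lipschitz_on A (\<lambda>x. sgn (\<psi> x))" by metis
    moreover have "norm (sgn (\<psi> x)) = 1" if "x \<in> A" for x
      using norm_\<psi>[OF that] by (auto simp: norm_sgn)
    then have "(\<lambda>x. sgn (\<psi> x)) ` A \<subseteq> sphere 0 1" by auto
    ultimately obtain f where f: "f ` X \<subseteq> sphere 0 1" "(C' * (16 * N * \<kappa>))-lipschitz_on X f"
      "\<forall>x\<in>A. f x = sgn (\<psi> x)"
      using ext'[OF \<open>A \<subseteq> X\<close>] by blast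
    define L where "L = C' * (16 * N * \<kappa>)"
    have norm_f: "norm (f x) = 1" if "x \<in> X" for x using f(1) that by auto
    define \<mu> where "\<mu> x = Min ((\<lambda>i. y i (f x)) ` I)" for x
    have \<mu>_le: "\<mu> x \<le> y i (f x)" if "i \<in> I" for i x
      unfolding \<mu>_def using that I by (intro Min_le) auto
    have \<mu>_in: "\<exists>i\<in>I. \<mu> x = y i (f x)" for x
    proof -
      have "\<mu> x \<in> (\<lambda>i. y i (f x)) ` I" unfolding \<mu>_def using I by (intro Min_in) auto
      then show ?thesis by blast
    qed
    define \<tau> where "\<tau> i x = y i (f x) - \<mu> x" for i x
    have lipy: "L-lipschitz_on X (\<lambda>x. y i (f x))" for i
    proof (rule lipschitz_onI)
      show "0 \<le> L" unfolding L_def by (rule lipschitz_on_nonneg[OF f(2)])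
      fix u v assume uv: "u \<in> X" "v \<in> X"
      have "dist (y i (f u)) (y i (f v)) \<le> dist (f u) (f v)"
        by (simp add: y_def dist_vec_nth_le)
      also have "\<dots> \<le> L * dist u v" unfolding L_def by (rule lipschitz_onD[OF f(2) uv])
      finally show "dist (y i (f u)) (y i (f v)) \<le> L * dist u v" .
    qed
    have lip\<tau>: "(L + L)-lipschitz_on X (\<tau> i)" for i
      unfolding \<tau>_def[abs_def] \<mu>_def using I lipy by (intro lipschitz_on_diff lipschitz_on_Min) auto
    have \<tau>_nonneg: "0 \<le> \<tau> i x" if "i \<in> I" for i x using \<mu>_le[OF that] by (simp add: \<tau>_def)
    have \<tau>_le: "\<bar>\<tau> i x\<bar> \<le> 2" if "x \<in> X" for i x
    proof -
      obtain i' where "\<mu> x = y i' (f x)" using \<mu>_in by blast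
      then show ?thesis
        using y_le[of i "f x"] y_le[of i' "f x"] norm_f[OF that] unfolding \<tau>_def by linarith
    qed
    have \<tau>_zero: "\<exists>i\<in>I. \<tau> i x = 0" for x using \<mu>_in[of x] by (auto simp: \<tau>_def)
    \<comment> \<open>A unit vector has a coordinate of size at least \<open>1 / N\<close>. If it is
      positive, its own entry of \<tau> is large, since \<mu> is at most the zero entry at
      \<open>z\<close>; if negative, \<mu> is so small that the entry at \<open>z\<close> is
      large.\<close>
    have \<tau>_large: "\<exists>i\<in>I. 1 / N \<le> \<tau> i x" if "x \<in> X" for x
    proof -
      have "\<exists>j. 1 / N \<le> \<bar>f x $ j\<bar>"
      proof (rule ccontr)
        assume "\<not> (\<exists>j. 1 / N \<le> \<bar>f x $ j\<bar>)"
        then have "(\<Sum>j\<in>UNIV. \<bar>f x $ j\<bar>) < (\<Sum>j\<in>(UNIV :: 'n set). 1 / N)"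
          by (intro sum_strict_mono) (auto simp: not_le)
        also have "\<dots> = 1" using N by (simp add: N_def)
        finally show False using norm_le_l1_cart[of "f x"] norm_f[OF that] by simp
      qed
      then obtain j where j: "1 / N \<le> \<bar>y (e j) (f x)\<bar>" by (auto simp: y_e)
      show ?thesis
      proof (cases "0 \<le> y (e j) (f x)")
        case True
        then have "1 / N \<le> \<tau> (e j) x" using j \<mu>_le[OF I(3), of x] by (simp add: \<tau>_def y_z)
        then show ?thesis using eI(1) by blast
      next
        case False
        then have "1 / N \<le> \<tau> z x" using j \<mu>_le[OF eI(1), of x j] by (simp add: \<tau>_def y_z)
        then show ?thesis using I(3) by blast
      qed
    qed
    \<comment> \<open>On \<open>A\<close> the entries of \<open>f x\<close> are those of \<phi>,
      shifted and rescaled by a positive factor, so an index where \<phi> vanishes attains the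
      minimum.\<close>
    have \<tau>_supp: "\<tau> i x = 0" if "x \<in> A" "i \<in> I" "\<phi> i x = 0" for i x
    proof -
      have y_f: "y i' (f x) = (\<phi> i' x - \<phi> z x) / norm (\<psi> x)" if "i' \<in> I" for i'
        using f(3) \<open>x \<in> A\<close> y_\<psi>[OF that] by (simp add: y_sgn)
      have "y i (f x) \<le> y i' (f x)" if i': "i' \<in> I" for i'
        unfolding y_f[OF i'] y_f[OF \<open>i \<in> I\<close>] using \<phi> \<open>\<phi> i x = 0\<close>
        by (intro divide_right_mono) auto
      then have "y i (f x) \<le> \<mu> x" using \<mu>_in[of x] by auto
      then show ?thesis using \<mu>_le[OF \<open>i \<in> I\<close>, of x] by (simp add: \<tau>_def)
    qed
    define g where "g i x = (if i \<in> I then \<rho> x * \<tau> i x else \<phi> i x)" for i x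
    have K: "K / r = L + 2 * \<kappa>" using r by (simp add: K_def L_def \<kappa>_def field_simps)
    have lipg: "(K / r)-lipschitz_on X (g i)" for i
    proof (cases "i \<in> I")
      case True
      have "(1/2 * (L + L) + 2 * \<kappa>)-lipschitz_on X (\<lambda>x. \<rho> x *\<^sub>R \<tau> i x)"
        using \<rho> \<tau>_le by (intro lipschitz_on_scaleR lip\<rho> lip\<tau>) auto
      then show ?thesis using True by (simp add: g_def[abs_def] K)
    next
      case False
      have "0 \<le> L" using lipschitz_on_nonneg[OF lipy] .
      then have "\<kappa> \<le> K / r" using \<kappa> by (simp add: K)
      then have "(K / r)-lipschitz_on X (\<phi> i)"
        by (rule lipschitz_on_mono[OF lip\<phi>[rule_format] order_refl])
      then show ?thesis using False by (simp add: g_def[abs_def])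
    qed
    have g_supp: "0 < \<phi> i x" if "x \<in> X" "0 < g i x" for i x
    proof (rule ccontr)
      assume "\<not> 0 < \<phi> i x"
      then have 0: "\<phi> i x = 0" using \<phi> by (metis less_eq_real_def)
      then have i: "i \<in> I" and "\<rho> x \<noteq> 0" "\<tau> i x \<noteq> 0" using that 0 by (auto simp: g_def split: if_splits)
      then have "x \<in> A" using that 0 i by (auto simp: A_def \<rho>_def max_def split: if_splits)
      then show False using \<tau>_supp i 0 \<open>\<tau> i x \<noteq> 0\<close> by blast
    qed
    have Ik: "I \<subseteq> {1..k+2}" using \<open>n \<le> k\<close> by (auto simp: I_def)
    show "\<exists>g (p :: nat \<Rightarrow> 'a \<Rightarrow> 'a set).
      (\<forall>i\<in>{1..k+2}. (K / r)-lipschitz_on X (g i) \<and> (\<forall>x\<in>X. (0::real) \<le> g i x) \<and>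
         scattered (1/2 * r) (C * r) {x\<in>X. 0 < g i x} (p i)) \<and>
      (\<forall>x\<in>X. (\<exists>i\<in>{1..k+2}. g i x = 0) \<and> (\<exists>i\<in>{1..k+2}. 1 / (2 * N) \<le> g i x))"
    proof (intro exI[of _ g] exI[of _ p] conjI ballI lipg)
      fix i x show "0 \<le> g i x" using \<rho> \<tau>_nonneg \<phi> by (simp add: g_def)
    next
      fix i assume "i \<in> {1..k+2}"
      then have "scattered (1/2 * r) (C * r) {x\<in>X. 0 < \<phi> i x} (p i)" using p by simp
      then show "scattered (1/2 * r) (C * r) {x\<in>X. 0 < g i x} (p i)"
        using g_supp by (elim scattered_mono) auto
    next
      fix x assume x: "x \<in> X"
      obtain i where "i \<in> I" "\<tau> i x = 0" using \<tau>_zero by blast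
      then have "i \<in> {1..k+2}" "g i x = 0" using Ik by (auto simp: g_def)
      then show "\<exists>i\<in>{1..k+2}. g i x = 0" by blast
      obtain i where i: "i \<in> {1..k+2}" "\<phi> i x = 1" using one x by auto
      show "\<exists>i\<in>{1..k+2}. 1 / (2 * N) \<le> g i x"
      \<comment> \<open>A bump equal to 1 in \<open>I\<close> gives \<rho> = 1/2, and some entry of
        \<tau> is at least \<open>1 / N\<close>; a bump outside \<open>I\<close> was left
        unchanged.\<close>
      proof (cases "i \<in> I")
        case True
        then have "1/2 \<le> \<rho> x" using M_ge[of i x] i by (simp add: \<rho>_def)
        moreover obtain i' where i': "i' \<in> I" "1 / N \<le> \<tau> i' x" using \<tau>_large[OF x] by blast
        ultimately have "1/2 * (1 / N) \<le> \<rho> x * \<tau> i' x" using N \<rho> by (intro mult_mono) auto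
        then have "1 / (2 * N) \<le> g i' x" using i' by (simp add: g_def)
        then show ?thesis using i' Ik by blast
      next
        case False
        have "1 / (2 * N) \<le> 1" using N by simp
        then show ?thesis using i False by (intro bexI[of _ i]) (auto simp: g_def)
      qed
    qed
  qed (use C in auto)
qed

theorem theorem4p1:
  fixes X :: "'a::metric_space set" and n :: nat
  assumes "finite_NA_dim X"
    and "CARD('n::finite) = n + 1"
  shows "lipschitz_extensor (sphere (0 :: real ^ 'n) 1) X \<longleftrightarrow> NA_dim_le X n"
proof
  assume ext: "lipschitz_extensor (sphere (0 :: real ^ 'n) 1) X"
  obtain k where k: "NA_dim_le X k" using assms(1) unfolding finite_NA_dim_def by blast
  show "NA_dim_le X n"
  proof (cases "n \<le> k")
    case True
    \<comment> \<open>The induction carries the dimension bound at \<open>k\<close> as a premise, so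
      each step descends from \<open>k + 1\<close> to \<open>k\<close> until \<open>n\<close> is
      reached.\<close>
    then show ?thesis using k
    proof (induction k rule: dec_induct)
      case (step k)
      then show ?case using sphere_extensor_imp_NA_dim_drop[OF ext assms(2), of k] by simp
    qed
  next
    case False
    then show ?thesis using NA_dim_le_mono[OF k] by simp
  qed
qed (rule NA_dim_le_imp_sphere_extensor[OF _ assms(2)])

end
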